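(* Let $m,n$ be positive integers, let $\Omega_1,\dots,\Omega_m$ be real skew-symmetric $n\times n$ matrices that are not all equal, let $k>0$, and let $A=(a_{ij})$ be the weighted adjacency matrix of a strongly connected weighted digraph on $\{1,\dots,m\}$. Consider the high-dimensional Kuramoto model with nonidentical oscillators on the unit sphere, $$\dot r_i=\Omega_i r_i+k\sum_{j=1}^m a_{ij}\big(r_j-(r_i^{\mathrm T}r_j)r_i\big),\qquad r_i\in\mathbf{R}^n,\ \|r_i\|=1,\qquad i=1,\dots,m,$$ and let $$W=\bigcap_{l=1}^{n}\{\xi\in\mathbf{R}^n : \Omega_1^l\xi=\Omega_2^l\xi=\cdots=\Omega_m^l\xi\}=\bigcap_{l=1}^{n}\bigcap_{i=2}^m\ker(\Omega_i^l-\Omega_1^l).$$ Then there is an open unit hemisphere $S=\{x\in\mathbf{R}^n:\|x\|=1,\ p^{\mathrm T}x>0\}$ (for some nonzero $p\in\mathbf{R}^n$) such that every solution with $r_i(0)\in S$ for all $i=1,\dots,m$ exhibits complete phase synchronization if and only if $\dim(W)>0$.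
   Context: The weighted adjacency matrix $A=(a_{ij})$ of a weighted digraph on vertices $\{1,\dots,m\}$ with edge set $\mathcal{E}$ satisfies $a_{ij}>0$ if $(j,i)\in\mathcal{E}$ and $a_{ij}=0$ otherwise. The digraph is strongly connected if for any two vertices there is a directed path from each to the other. Each $\|r_i(t)\|$ is constant along solutions, so the unit sphere constraint is preserved by the flow. A solution $r(t)=(r_1^{\mathrm T}(t),\dots,r_m^{\mathrm T}(t))^{\mathrm T}$ is said to exhibit (achieve) complete phase synchronization if $\lim_{t\to+\infty}(r_i(t)-r_j(t))=0$ for all $1\le i,j\le m$. The norm is Euclidean. *)

theory Defs
  imports "HOL-Analysis.Analysis"
begin

(* The operations * and ^ on real^'n^'n are componentwise in HOL-Analysis,
   so powers with respect to the matrix product ** are defined here. *)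
primrec matpow :: "real^'n^'n \<Rightarrow> nat \<Rightarrow> real^'n^'n" where
  "matpow M 0 = mat 1"
| "matpow M (Suc l) = M ** matpow M l"

definition skew_symmetric :: "real^'n^'n \<Rightarrow> bool" where
  "skew_symmetric M \<longleftrightarrow> transpose M = - M"

(* Entry (i, j) is the weight of the edge from j to i. *)
definition weighted_adjacency :: "('m \<times> 'm) set \<Rightarrow> real^'m^'m \<Rightarrow> bool" where
  "weighted_adjacency E A \<longleftrightarrow>
     (\<forall>i j. if (j, i) \<in> E then A $ i $ j > 0 else A $ i $ j = 0)"

definition strongly_connected_digraph :: "('m \<times> 'm) set \<Rightarrow> bool" where
  "strongly_connected_digraph E \<longleftrightarrow> (\<forall>i j. (i, j) \<in> E\<^sup>*)"

definition kuramoto_field ::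
    "('m \<Rightarrow> real^'n^'n) \<Rightarrow> real \<Rightarrow> real^'m^'m \<Rightarrow> real^'n^'m \<Rightarrow> 'm \<Rightarrow> real^'n" where
  "kuramoto_field \<Omega> k A x i =
     \<Omega> i *v (x $ i)
     + k *\<^sub>R (\<Sum>j\<in>UNIV. (A $ i $ j) *\<^sub>R (x $ j - (x $ i \<bullet> x $ j) *\<^sub>R (x $ i)))"

(* Only the values of r at nonnegative times matter; at time 0 the derivative is one-sided. *)
definition kuramoto_solution ::
    "('m \<Rightarrow> real^'n^'n) \<Rightarrow> real \<Rightarrow> real^'m^'m \<Rightarrow> (real \<Rightarrow> real^'n^'m) \<Rightarrow> bool" where
  "kuramoto_solution \<Omega> k A r \<longleftrightarrow>
     (\<forall>t\<ge>0. \<forall>i. norm (r t $ i) = 1 \<and>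
        ((\<lambda>s. r s $ i) has_vector_derivative kuramoto_field \<Omega> k A (r t) i) (at t within {0..}))"

definition complete_phase_sync :: "(real \<Rightarrow> real^'n^'m) \<Rightarrow> bool" where
  "complete_phase_sync r \<longleftrightarrow> (\<forall>i j. ((\<lambda>t. r t $ i - r t $ j) \<longlongrightarrow> 0) at_top)"

definition open_hemisphere :: "real^'n \<Rightarrow> (real^'n) set" where
  "open_hemisphere p = {x. norm x = 1 \<and> p \<bullet> x > 0}"

definition common_power_space :: "('m \<Rightarrow> real^'n^'n) \<Rightarrow> (real^'n) set" where
  "common_power_space \<Omega> =
     (\<Inter>l\<in>{1..CARD('n)}. {\<xi>. \<forall>i j. matpow (\<Omega> i) l *v \<xi> = matpow (\<Omega> j) l *v \<xi>})"

lemma subspace_common_power_space: "subspace (common_power_space \<Omega>)"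
proof (rule subspaceI)
  show "0 \<in> common_power_space \<Omega>"
    by (simp add: common_power_space_def)
next
  fix x y assume "x \<in> common_power_space \<Omega>" "y \<in> common_power_space \<Omega>"
  then show "x + y \<in> common_power_space \<Omega>"
    unfolding common_power_space_def INT_iff mem_Collect_eq matrix_vector_right_distrib
    by (intro ballI allI arg_cong2[where f = "(+)"]) blast+
next
  fix c :: real and x assume "x \<in> common_power_space \<Omega>"
  then show "c *\<^sub>R x \<in> common_power_space \<Omega>"
    unfolding common_power_space_def INT_iff mem_Collect_eq matrix_vector_mult_scaleR
    by (intro ballI allI arg_cong[where f = "(*\<^sub>R) c"]) blast
qed

end

theory Submission
  imports Defs
begin

text \<open>If a solution synchronizes, Barbalat's lemma applied inductively to
  \<open>(\<Omega>\<^sub>i\<^sup>l - \<Omega>\<^sub>j\<^sup>l) r\<^sub>i\<close> gives \<open>(\<Omega>\<^sub>i\<^sup>l - \<Omega>\<^sub>j\<^sup>l) r\<^sub>i \<longlonglongrightarrow> 0\<close> for all \<open>l\<close>, so every limit point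
  of \<open>r\<^sub>i\<close> is a unit vector in \<open>W\<close>; at least one solution starts in the hemisphere because the
  system is solvable from every initial value.

  Conversely, let \<open>p \<noteq> 0\<close> lie in \<open>W\<close>. All \<open>\<Omega>\<^sub>i\<close> agree on the invariant Krylov space of \<open>p\<close>, so
  \<open>p\<close> can be moved along a curve with \<open>p' = \<Omega>\<^sub>i p\<close> for every \<open>i\<close> at once. By skew symmetry the heights
  \<open>u\<^sub>i = p \<bullet> r\<^sub>i\<close> satisfy \<open>u\<^sub>i' = k \<Sum>\<^sub>j a\<^sub>i\<^sub>j (u\<^sub>j - (r\<^sub>i \<bullet> r\<^sub>j) u\<^sub>i)\<close>, hence stay above their positive initial
  minimum. With \<open>w > 0\<close> a left null vector of the graph Laplacian, \<open>V = \<Sum>\<^sub>i w\<^sub>i u\<^sub>i\<close> has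
  \<open>V' = k \<Sum>\<^sub>i\<^sub>j w\<^sub>i a\<^sub>i\<^sub>j (1 - r\<^sub>i \<bullet> r\<^sub>j) u\<^sub>i \<ge> 0\<close>. As \<open>V\<close> is bounded, \<open>V'\<close> tends to \<open>0\<close>, which
  synchronizes the two ends of every edge.\<close>

section \<open>Global solutions of differential equations with Lipschitz right-hand side\<close>

text \<open>The integral of \<open>B * exp (c * s)\<close> is
  \<open>B * (exp (c * t) - 1) / c\<close>, and the weight \<open>exp (- (c * t))\<close> cancels
  the growth. The estimate serves twice: for the boundedness of a Picard iterate and for the
  contraction factor.\<close>

lemma norm_exp_integral_le:
  fixes h :: "real \<Rightarrow> 'a::banach"
  assumes "c > 0" "0 \<le> t" and cont: "continuous_on {0..t} h"
    and bound: "\<And>s. s \<in> {0..t} \<Longrightarrow> norm (h s) \<le> B * exp (c * s)"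
  shows "norm (exp (- (c * t)) *\<^sub>R integral {0..t} h) \<le> B / c"
proof -
  have "norm (h 0) \<le> B" using bound[of 0] \<open>0 \<le> t\<close> by simp
  then have "B \<ge> 0" using norm_ge_zero order_trans by blast
  have "((\<lambda>s. B * exp (c * s)) has_integral B * exp (c * t) / c - B * exp (c * 0) / c) {0..t}"
    using \<open>c > 0\<close> \<open>0 \<le> t\<close>
    by (intro fundamental_theorem_of_calculus)
       (auto simp flip: has_real_derivative_iff_has_vector_derivative intro!: derivative_eq_intros)
  moreover from this have "norm (integral {0..t} h) \<le> integral {0..t} (\<lambda>s. B * exp (c * s))"
    by (intro Henstock_Kurzweil_Integration.integral_norm_bound_integral
        integrable_continuous_real cont bound continuous_intros)
  ultimately have "norm (integral {0..t} h) \<le> B * exp (c * t) / c - B / c"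
    by (simp only: integral_unique mult_zero_right exp_zero mult_1_right)
  also have "\<dots> \<le> B * exp (c * t) / c"
    using \<open>B \<ge> 0\<close> \<open>c > 0\<close> by simp
  finally have "exp (- (c * t)) * norm (integral {0..t} h) \<le> exp (- (c * t)) * (B * exp (c * t) / c)"
    by (intro mult_left_mono) auto
  also have "\<dots> = B / c" by (simp add: exp_minus field_simps)
  finally show ?thesis by simp
qed

text \<open>Picard iteration contracts on the whole half-line once a curve \<open>x\<close> is written as
  \<open>x t = exp (c * t) *\<^sub>R u t\<close> with \<open>u\<close> bounded and \<open>c\<close> larger than the Lipschitz constant.\<close>

lemma lipschitz_ode_global_solution:
  fixes G :: "'a::banach \<Rightarrow> 'a"
  assumes lip: "L-lipschitz_on UNIV G"
  obtains x where "x 0 = z"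
    "\<And>t. t \<ge> 0 \<Longrightarrow> (x has_vector_derivative G (x t)) (at t within {0..})"
proof -
  \<comment> \<open>Any \<open>c > L\<close> makes the contraction factor \<open>L / c\<close>
    smaller than 1; adding 1 also keeps \<open>c\<close> positive when \<open>L = 0\<close>.\<close>
  define c where "c = L + 1"
  have "L \<ge> 0" using lip by (rule lipschitz_on_nonneg)
  then have "c > 0" by (simp add: c_def)
  have GD: "norm (G a - G b) \<le> L * norm (a - b)" for a b
    using lipschitz_onD[OF lip, of a b] by (simp add: dist_norm)
  have contG: "continuous_on S G" for S
    using lipschitz_on_continuous_on[OF lip] continuous_on_subset by blast
  define H :: "(real \<Rightarrow>\<^sub>C 'a) \<Rightarrow> real \<Rightarrow> 'a" where "H u s = G (exp (c * s) *\<^sub>R u s)" for u s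
  have contH: "continuous_on S (H u)" for S u
    unfolding H_def by (intro continuous_on_compose2[OF contG[of UNIV]] continuous_intros) auto
  \<comment> \<open>The Picard operator on rescaled curves. Elements of \<open>bcontfun\<close> live
    on the whole real line, so \<open>max 0 t\<close> extends the iterate by a constant to negative
    times.\<close>
  define \<Phi> where "\<Phi> u t =
    exp (- (c * max 0 t)) *\<^sub>R (z + integral {0..max 0 t} (H u))" for u t
  have "\<Phi> u \<in> bcontfun" for u
  proof (rule bcontfun_normI)
    have int: "continuous_on {0..} (\<lambda>t. integral {0..t} (H u))"
      unfolding continuous_on_eq_continuous_within
    proof
      fix t :: real assume "t \<in> {0..}"
      then have "((\<lambda>t. integral {0..t} (H u)) has_vector_derivative H u t) (at t within {0..t+1})"
        by (intro integral_has_vector_derivative contH) auto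
      moreover have "at t within {0..t+1} = at t within {0..}"
        by (rule at_within_nhd[of _ "{..<t+1}"]) auto
      ultimately show "continuous (at t within {0..}) (\<lambda>t. integral {0..t} (H u))"
        using has_vector_derivative_continuous by metis
    qed
    show "continuous_on UNIV (\<Phi> u)"
      unfolding \<Phi>_def
      by (intro continuous_intros continuous_on_compose2[OF int]) auto
    show "norm (\<Phi> u t) \<le> norm z + (norm (G 0) + L * norm u) / c" for t
    proof -
      have "norm (H u s) \<le> (norm (G 0) + L * norm u) * exp (c * s)" if "s \<in> {0..max 0 t}" for s
      proof -
        have "norm (H u s) \<le> norm (G 0) + norm (H u s - G 0)"
          using norm_triangle_ineq[of "G 0" "H u s - G 0"] by simp
        also have "norm (H u s - G 0) \<le> L * norm (exp (c * s) *\<^sub>R u s)"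
          unfolding H_def by (rule GD[of _ 0, simplified])
        also have "\<dots> \<le> L * (exp (c * s) * norm u)"
          using norm_bounded[of u s] \<open>L \<ge> 0\<close> by (intro mult_left_mono) auto
        also have "norm (G 0) \<le> norm (G 0) * exp (c * s)"
          using that \<open>c > 0\<close> mult_left_mono[of 1 "exp (c * s)" "norm (G 0)"] by simp
        finally show ?thesis by (simp add: algebra_simps)
      qed
      then have "norm (exp (- (c * max 0 t)) *\<^sub>R integral {0..max 0 t} (H u))
          \<le> (norm (G 0) + L * norm u) / c"
        using \<open>c > 0\<close> by (intro norm_exp_integral_le contH) auto
      moreover have "norm (exp (- (c * max 0 t)) *\<^sub>R z) \<le> norm z"
        using \<open>c > 0\<close> by (auto intro!: mult_left_le_one_le)
      ultimately show ?thesis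
        unfolding \<Phi>_def scaleR_add_right by (rule norm_triangle_le[OF add_mono, rotated])
    qed
  qed
  then have app: "apply_bcontfun (Bcontfun (\<Phi> u)) = \<Phi> u" for u
    by (simp add: Bcontfun_inverse)
  have "dist (Bcontfun (\<Phi> u)) (Bcontfun (\<Phi> v)) \<le> L / c * dist u v" for u v
  proof (rule dist_bound, unfold app)
    fix t :: real
    have "\<Phi> u t - \<Phi> v t
        = exp (- (c * max 0 t)) *\<^sub>R integral {0..max 0 t} (\<lambda>s. H u s - H v s)"
      unfolding \<Phi>_def scaleR_diff_right[symmetric]
      by (subst Henstock_Kurzweil_Integration.integral_diff)
         (auto intro!: integrable_continuous_real contH)
    also have "norm \<dots> \<le> L * dist u v / c"
    proof (rule norm_exp_integral_le)
      show "norm (H u s - H v s) \<le> L * dist u v * exp (c * s)" for s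
      proof -
        have "norm (H u s - H v s) \<le> L * norm (exp (c * s) *\<^sub>R (u s - v s))"
          unfolding H_def scaleR_diff_right by (rule GD)
        also have "\<dots> \<le> L * (exp (c * s) * dist u v)"
          using dist_bounded[of u s v] \<open>L \<ge> 0\<close> by (intro mult_left_mono) (auto simp: dist_norm)
        finally show ?thesis by (simp add: algebra_simps)
      qed
    qed (use \<open>c > 0\<close> in \<open>auto intro!: continuous_intros contH\<close>)
    finally show "dist (\<Phi> u t) (\<Phi> v t) \<le> L / c * dist u v" by (simp add: dist_norm)
  qed
  then obtain u where "Bcontfun (\<Phi> u) = u"
    using banach_fix_type[of "L / c" "\<lambda>u. Bcontfun (\<Phi> u)"] \<open>L \<ge> 0\<close> \<open>c > 0\<close>
    by (auto simp: c_def)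
  then have fix_u: "apply_bcontfun u = \<Phi> u" using app by metis
  define x where "x t = exp (c * t) *\<^sub>R u t" for t
  have x_eq: "x t = z + integral {0..t} (\<lambda>s. G (x s))" if "t \<ge> 0" for t
  proof -
    have "H u = (\<lambda>s. G (x s))" by (simp add: H_def x_def fun_eq_iff)
    then show ?thesis
      using that unfolding x_def[of t] fix_u by (simp add: \<Phi>_def max_def flip: exp_add)
  qed
  show thesis
  proof (rule that)
    show "x 0 = z" using x_eq[of 0] by simp
    fix t :: real assume "t \<ge> 0"
    have "continuous_on {0..t+1} (\<lambda>s. G (x s))"
      using contH[of _ u] unfolding H_def x_def .
    then have "((\<lambda>t. z + integral {0..t} (\<lambda>s. G (x s))) has_vector_derivative 0 + G (x t))
        (at t within {0..t+1})"
      using \<open>t \<ge> 0\<close> by (intro has_vector_derivative_add has_vector_derivative_const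
          integral_has_vector_derivative) auto
    then have "(x has_vector_derivative G (x t)) (at t within {0..t+1})"
      using \<open>t \<ge> 0\<close> x_eq by (subst has_vector_derivative_cong_ev) (auto intro!: always_eventually)
    moreover have "at t within {0..t+1} = at t within {0..}"
      using \<open>t \<ge> 0\<close> by (intro at_within_nhd[of _ "{..<t+1}"]) auto
    ultimately show "(x has_vector_derivative G (x t)) (at t within {0..})" by simp
  qed
qed

section \<open>Barbalat's lemma\<close>

text \<open>Over a window of fixed length \<open>h\<close> the increment of \<open>f\<close> equals
  \<open>h *\<^sub>R g t\<close> up to an error of at most \<open>h * (L * h)\<close>, and the
  increment tends to 0 because \<open>f\<close> converges. The Lipschitz condition stands in for the
  usual uniform continuity of the derivative.\<close>

lemma barbalat:
  fixes f g :: "real \<Rightarrow> 'a::real_normed_vector"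
  assumes der: "\<And>t. t \<ge> 0 \<Longrightarrow> (f has_vector_derivative g t) (at t within {0..})"
    and lip: "L-lipschitz_on {0..} g" and lim: "(f \<longlongrightarrow> l) at_top"
  shows "(g \<longlongrightarrow> 0) at_top"
proof (rule tendstoI)
  fix e :: real assume "e > 0"
  have "L \<ge> 0" using lip by (rule lipschitz_on_nonneg)
  \<comment> \<open>The window is short enough for \<open>g\<close> to vary by less than
    \<open>e / 2\<close> on it; the other half of \<open>e\<close> is left for the increment of
    \<open>f\<close> divided by \<open>h\<close>.\<close>
  define h where "h = e / (2 * (L + 1))"
  have "h > 0" "L * h < e / 2"
    using \<open>e > 0\<close> \<open>L \<ge> 0\<close> by (auto simp: h_def field_simps)
  have "((\<lambda>t. f (t + h)) \<longlongrightarrow> l) at_top"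
    by (intro filterlim_compose[OF lim] filterlim_at_top_mono[OF filterlim_ident])
       (use \<open>h > 0\<close> in auto)
  then have "((\<lambda>t. f (t + h) - f t) \<longlongrightarrow> 0) at_top"
    using tendsto_diff[OF _ lim] by fastforce
  then have "eventually (\<lambda>t. norm (f (t + h) - f t) < h * (e / 2)) at_top"
    using tendstoD[of _ 0 at_top "h * (e / 2)"] \<open>h > 0\<close> \<open>e > 0\<close> by fastforce
  then show "eventually (\<lambda>t. dist (g t) 0 < e) at_top"
    using eventually_ge_at_top[of 0]
  proof eventually_elim
    case (elim t)
    have "norm (f (t + h) - f t - ((t + h) - t) *\<^sub>R g t) \<le> norm ((t + h) - t) * (L * h)"
    proof (rule vector_differentiable_bound_linearization[where S = "{t..t+h}"])
      fix s assume s: "s \<in> {t..t+h}"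
      then show "(f has_vector_derivative g s) (at s within {t..t+h})"
        using der[of s] elim by (auto intro: has_vector_derivative_within_subset)
      have "norm (g s - g t) \<le> L * norm (s - t)"
        using lipschitz_onD[OF lip, of s t] s elim by (simp add: dist_norm)
      also have "\<dots> \<le> L * h" using s \<open>L \<ge> 0\<close> by (intro mult_left_mono) auto
      finally show "norm (g s - g t) \<le> L * h" .
    qed (use \<open>h > 0\<close> in \<open>auto simp: closed_segment_eq_real_ivl\<close>)
    then have "norm (f (t + h) - f t - h *\<^sub>R g t) \<le> h * (L * h)" using \<open>h > 0\<close> by simp
    moreover have "norm (h *\<^sub>R g t) \<le> norm (f (t + h) - f t) + norm (f (t + h) - f t - h *\<^sub>R g t)"
      using norm_triangle_ineq4[of "f (t + h) - f t" "f (t + h) - f t - h *\<^sub>R g t"] by simp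
    ultimately have "h * norm (g t) < h * (e / 2) + h * (L * h)"
      using elim \<open>h > 0\<close> by simp
    then have "h * norm (g t) < h * (e / 2 + L * h)" by (simp add: algebra_simps)
    then have "norm (g t) < e / 2 + L * h" using \<open>h > 0\<close> by simp
    then show ?case using \<open>L * h < e / 2\<close> by simp
  qed
qed

section \<open>A calculus of bounded Lipschitz maps\<close>

text \<open>Products of Lipschitz maps need not be Lipschitz unless the factors are bounded.
  Bundling both properties gives a class closed under sums and bilinear products, so that membership
  follows from the shape of a term; this supplies the Lipschitz hypothesis of
  \<open>barbalat\<close>.\<close>

definition bounded_lipschitz ::
    "'a::metric_space set \<Rightarrow> ('a \<Rightarrow> 'b::real_normed_vector) \<Rightarrow> bool" where
  "bounded_lipschitz S f \<longleftrightarrow> bounded (f ` S) \<and> (\<exists>L. L-lipschitz_on S f)"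

lemma bounded_lipschitz_const: "bounded_lipschitz S (\<lambda>x. c)"
  unfolding bounded_lipschitz_def by (auto intro: lipschitz_on_constant bounded_subset[of "{c}"])

lemma bounded_lipschitz_linear:
  assumes "bounded_linear h" "bounded_lipschitz S f"
  shows "bounded_lipschitz S (\<lambda>x. h (f x))"
proof -
  from assms(2) obtain L where "bounded (f ` S)" "L-lipschitz_on S f"
    by (auto simp: bounded_lipschitz_def)
  moreover obtain B where "B-lipschitz_on (f ` S) h"
    using bounded_linear.lipschitz_boundE[OF assms(1)] by blast
  ultimately show ?thesis
    using bounded_linear_image[OF _ assms(1), of "f ` S"] lipschitz_on_compose2[of L S f B h]
    by (auto simp: bounded_lipschitz_def image_image)
qed

lemma bounded_lipschitz_add:
  assumes "bounded_lipschitz S f" "bounded_lipschitz S g"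
  shows "bounded_lipschitz S (\<lambda>x. f x + g x)"
  using assms unfolding bounded_lipschitz_def by (auto intro: bounded_plus_comp lipschitz_on_add)

lemma bounded_lipschitz_diff:
  assumes "bounded_lipschitz S f" "bounded_lipschitz S g"
  shows "bounded_lipschitz S (\<lambda>x. f x - g x)"
  using assms unfolding bounded_lipschitz_def by (auto intro: bounded_minus_comp lipschitz_on_diff)

lemma bounded_lipschitz_sum:
  assumes "\<And>i. i \<in> I \<Longrightarrow> bounded_lipschitz S (f i)"
  shows "bounded_lipschitz S (\<lambda>x. \<Sum>i\<in>I. f i x)"
  using assms
  by (induction I rule: infinite_finite_induct)
     (auto intro: bounded_lipschitz_const bounded_lipschitz_add)

lemma bounded_lipschitz_bilinear:
  assumes "bounded_bilinear p" "bounded_lipschitz S f" "bounded_lipschitz S g"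
  shows "bounded_lipschitz S (\<lambda>x. p (f x) (g x))"
proof -
  interpret bounded_bilinear p by fact
  from assms obtain F G L M where
    F: "\<And>x. x \<in> S \<Longrightarrow> norm (f x) \<le> F" and G: "\<And>x. x \<in> S \<Longrightarrow> norm (g x) \<le> G"
    and L: "L-lipschitz_on S f" and M: "M-lipschitz_on S g"
    by (simp add: bounded_lipschitz_def bounded_iff) blast
  obtain K where K: "\<And>a b. norm (p a b) \<le> norm a * norm b * K" "K > 0"
    using pos_bounded by blast
  have LM: "L \<ge> 0" "M \<ge> 0" using L M lipschitz_on_nonneg by auto
  have FG: "\<bar>F\<bar> \<ge> norm (f x)" "\<bar>G\<bar> \<ge> norm (g x)" if "x \<in> S" for x
    using F[OF that] G[OF that] by auto
  have "norm (p (f x) (g x)) \<le> \<bar>F\<bar> * \<bar>G\<bar> * K" if "x \<in> S" for x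
    by (rule order_trans[OF K(1)]) (use FG[OF that] K(2) in \<open>auto intro!: mult_mono\<close>)
  then have "bounded ((\<lambda>x. p (f x) (g x)) ` S)" by (auto simp: bounded_iff)
  moreover have "((L * \<bar>G\<bar> + \<bar>F\<bar> * M) * K)-lipschitz_on S (\<lambda>x. p (f x) (g x))"
  proof (rule lipschitz_onI)
    fix x y assume xy: "x \<in> S" "y \<in> S"
    have d: "norm (f x - f y) \<le> L * dist x y" "norm (g x - g y) \<le> M * dist x y"
      using lipschitz_onD[OF L xy] lipschitz_onD[OF M xy] by (auto simp: dist_norm)
    have "p (f x) (g x) - p (f y) (g y) = p (f x - f y) (g x) + p (f y) (g x - g y)"
      by (simp add: diff_left diff_right)
    also have "norm \<dots> \<le> norm (f x - f y) * norm (g x) * K + norm (f y) * norm (g x - g y) * K"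
      by (rule norm_triangle_le[OF add_mono]) (rule K)+
    also have "\<dots> \<le> (L * dist x y) * \<bar>G\<bar> * K + \<bar>F\<bar> * (M * dist x y) * K"
      using d FG xy K(2) LM by (intro add_mono mult_right_mono mult_mono) auto
    finally show "dist (p (f x) (g x)) (p (f y) (g y)) \<le> (L * \<bar>G\<bar> + \<bar>F\<bar> * M) * K * dist x y"
      by (simp add: dist_norm algebra_simps)
  qed (use LM K in auto)
  ultimately show ?thesis by (auto simp: bounded_lipschitz_def)
qed

lemmas bounded_lipschitz_intros =
  bounded_lipschitz_const bounded_lipschitz_add bounded_lipschitz_diff bounded_lipschitz_sum
  bounded_lipschitz_bilinear[OF bounded_bilinear_scaleR]
  bounded_lipschitz_bilinear[OF bounded_bilinear_inner]
  bounded_lipschitz_bilinear[OF bounded_bilinear_mult]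
  bounded_lipschitz_linear[OF matrix_vector_mul_bounded_linear]

lemma bounded_lipschitz_halfline:
  fixes f g :: "real \<Rightarrow> 'a::real_normed_vector"
  assumes der: "\<And>t. t \<ge> 0 \<Longrightarrow> (f has_vector_derivative g t) (at t within {0..})"
    and "bounded (f ` {0..})" "bounded (g ` {0..})"
  shows "bounded_lipschitz {0..} f"
proof -
  from assms(3) obtain B where B: "\<And>t. t \<ge> 0 \<Longrightarrow> norm (g t) \<le> B"
    by (auto simp: bounded_iff)
  then have "B \<ge> 0" using norm_ge_zero order_trans by blast
  have "B-lipschitz_on {0..} f"
  proof (rule lipschitz_onI)
    fix x y :: real assume "x \<in> {0..}" "y \<in> {0..}"
    then show "dist (f x) (f y) \<le> B * dist x y"
      unfolding dist_norm
      using der B by (intro differentiable_bound[of "{0..}" f "\<lambda>t h. h *\<^sub>R g t"])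
         (auto simp: has_vector_derivative_def onorm_scaleR_left bounded_linear_ident onorm_id)
  qed fact
  then show ?thesis using assms(2) by (auto simp: bounded_lipschitz_def)
qed

text \<open>Only the outer map has to be bounded. This admits coordinate projections, which are
  unbounded on the whole space, as inner maps.\<close>

lemma bounded_lipschitz_compose:
  assumes "bounded_lipschitz UNIV h" "L-lipschitz_on S f"
  shows "bounded_lipschitz S (\<lambda>x. h (f x))"
proof -
  from assms(1) obtain M where "bounded (range h)" "M-lipschitz_on UNIV h"
    by (auto simp: bounded_lipschitz_def)
  then have "bounded ((\<lambda>x. h (f x)) ` S)" "(M * L)-lipschitz_on S (\<lambda>x. h (f x))"
    using assms(2) by (auto intro: bounded_subset lipschitz_on_compose2 lipschitz_on_subset)
  then show ?thesis by (auto simp: bounded_lipschitz_def)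
qed

text \<open>A vector is the sum of its coordinates pushed through the linear embeddings
  \<open>axis i\<close>, so the rules for linear images and sums apply.\<close>

lemma bounded_lipschitz_vec:
  fixes f :: "'a::metric_space \<Rightarrow> 'm::finite \<Rightarrow> 'b::real_normed_vector"
  assumes "\<And>i. bounded_lipschitz S (\<lambda>x. f x i)"
  shows "bounded_lipschitz S (\<lambda>x. \<chi> i. f x i)"
proof -
  have "bounded_linear (axis i :: 'b \<Rightarrow> 'b^'m)" for i
  proof (rule bounded_linear_intro[where K = 1])
    fix x :: 'b
    have "norm (axis i x :: 'b^'m) \<le> (\<Sum>j\<in>UNIV. norm ((axis i x :: 'b^'m) $ j))"
      unfolding norm_vec_def by (rule L2_set_le_sum) simp
    also have "\<dots> = norm x"
      by (simp add: axis_def if_distrib[of norm] cong: if_cong)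
    finally show "norm (axis i x :: 'b^'m) \<le> norm x * 1" by simp
  qed (simp_all add: axis_def vec_eq_iff)
  then have "bounded_lipschitz S (\<lambda>x. \<Sum>i\<in>UNIV. axis i (f x i))"
    by (intro bounded_lipschitz_sum bounded_lipschitz_linear[where h = "axis _"] assms)
  moreover have "(\<Sum>i\<in>UNIV. axis i (f x i)) = (\<chi> i. f x i)" for x
    by (simp add: vec_eq_iff axis_def if_distrib[of "\<lambda>v. v $ _"])
  ultimately show ?thesis by simp
qed

text \<open>With \<open>a\<close> and \<open>b\<close> the two denominators, the difference of the
  images splits into \<open>(x - y) /\<^sub>R a\<close> and a multiple of \<open>y\<close> with
  coefficient \<open>(b - a) / (a * b)\<close>. Each piece has norm at most
  \<open>norm (x - y)\<close>, whence the constant 2.\<close>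

lemma bounded_lipschitz_radial_retraction:
  "bounded_lipschitz UNIV (\<lambda>x::'a::real_normed_vector. x /\<^sub>R max 1 (norm x))"
  unfolding bounded_lipschitz_def
proof (intro conjI exI)
  show "bounded (range (\<lambda>x::'a. x /\<^sub>R max 1 (norm x)))"
    unfolding bounded_iff by (intro exI[of _ 1]) (auto simp: divide_le_eq_1 max_def divide_inverse_commute[symmetric])
  show "2-lipschitz_on UNIV (\<lambda>x::'a. x /\<^sub>R max 1 (norm x))"
  proof (rule lipschitz_onI)
    fix x y :: 'a
    define a b where "a = max 1 (norm x)" and "b = max 1 (norm y)"
    have ab: "a \<ge> 1" "b \<ge> 1" "norm y \<le> b" by (auto simp: a_def b_def)
    have "\<bar>b - a\<bar> \<le> norm (x - y)"
      using norm_triangle_ineq3[of x y] by (auto simp: a_def b_def)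
    moreover have "x /\<^sub>R a - y /\<^sub>R b = (x - y) /\<^sub>R a + ((b - a) / (a * b)) *\<^sub>R y"
    proof -
      have "(b - a) / (a * b) = inverse a - inverse b" using ab by (simp add: field_simps)
      then show ?thesis by (simp add: scaleR_diff_left scaleR_diff_right)
    qed
    moreover have "norm ((x - y) /\<^sub>R a) \<le> norm (x - y)"
      using ab mult_left_le[of "inverse a" "norm (x - y)"] by (simp add: mult.commute inverse_le_1_iff)
    moreover have "norm (((b - a) / (a * b)) *\<^sub>R y) \<le> \<bar>b - a\<bar>"
    proof -
      have "norm y / (a * b) \<le> b / (1 * b)" using ab by (intro frac_le mult_right_mono) auto
      also have "\<dots> = 1" using ab by simp
      finally have "\<bar>b - a\<bar> * (norm y / (a * b)) \<le> \<bar>b - a\<bar>" by (intro mult_left_le) auto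
      then show ?thesis using ab by (simp add: abs_mult)
    qed
    ultimately show "dist (x /\<^sub>R max 1 (norm x)) (y /\<^sub>R max 1 (norm y)) \<le> 2 * dist x y"
      using norm_triangle_ineq[of "(x - y) /\<^sub>R a" "((b - a) / (a * b)) *\<^sub>R y"]
      unfolding a_def[symmetric] b_def[symmetric] dist_norm by simp
  qed simp
qed

section \<open>Skew symmetry and solvability of the Kuramoto system\<close>

lemma inner_skew:
  assumes "skew_symmetric M"
  shows "x \<bullet> (M *v y) = - ((M *v x) \<bullet> y)"
proof -
  have "x \<bullet> (M *v y) = (transpose M *v x) \<bullet> y"
    by (simp add: dot_lmul_matrix transpose_matrix_vector)
  also have "transpose M *v x = - (M *v x)"
    using assms matrix_vector_mult_diff_rdistrib[of 0 M x] by (simp add: skew_symmetric_def)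
  finally show ?thesis by simp
qed

lemma has_vector_derivative_inner:
  assumes "(f has_vector_derivative f') (at t within S)" "(g has_vector_derivative g') (at t within S)"
  shows "((\<lambda>t. f t \<bullet> g t) has_real_derivative f t \<bullet> g' + f' \<bullet> g t) (at t within S)"
  unfolding has_real_derivative_iff_has_vector_derivative
  by (rule bounded_bilinear.has_vector_derivative[OF bounded_bilinear_inner assms])

lemma inner_self_constant:
  fixes x :: "real \<Rightarrow> 'a::real_inner"
  assumes der: "\<And>t. t \<ge> 0 \<Longrightarrow> (x has_vector_derivative x' t) (at t within {0..})"
    and orth: "\<And>t. t \<ge> 0 \<Longrightarrow> x t \<bullet> x' t = 0" and "t \<ge> 0"
  shows "norm (x t) = norm (x 0)"
proof -
  have "((\<lambda>t. x t \<bullet> x t) has_real_derivative 0) (at s within {0..})" if "s \<in> {0..}" for s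
    using has_vector_derivative_inner[OF der der, of s] orth[of s] that
    by (simp add: inner_commute)
  then obtain C where "\<And>s. s \<in> {0..} \<Longrightarrow> x s \<bullet> x s = C"
    using has_field_derivative_zero_constant[of "{0..}" "\<lambda>t. x t \<bullet> x t"] by auto
  then show ?thesis using \<open>t \<ge> 0\<close> by (simp add: norm_eq_sqrt_inner)
qed

text \<open>The field is replaced by a globally Lipschitz one that agrees with it on unit vectors and is
  tangent to every sphere: \<open>r\<^sub>j\<close> acquires the factor \<open>r\<^sub>i \<bullet> r\<^sub>i\<close>, and arguments are retracted to the
  unit ball. Tangency keeps the norms, so its solutions solve the original system.\<close>

lemma kuramoto_solution_exists:
  fixes \<Omega> :: "'m::finite \<Rightarrow> real^'n^'n" and x0 :: "real^'n^'m"
  assumes skew: "\<And>i. skew_symmetric (\<Omega> i)" and x0: "\<And>i. norm (x0 $ i) = 1"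
  obtains r where "kuramoto_solution \<Omega> k A r" "r 0 = x0"
proof -
  define y :: "real^'n^'m \<Rightarrow> 'm \<Rightarrow> real^'n" where "y x i = x $ i /\<^sub>R max 1 (norm (x $ i))" for x i
  define g where "g x i = \<Omega> i *v y x i + k *\<^sub>R (\<Sum>j\<in>UNIV. (A $ i $ j) *\<^sub>R
      ((y x i \<bullet> y x i) *\<^sub>R y x j - (y x i \<bullet> y x j) *\<^sub>R y x i))" for x i
  have "bounded_lipschitz UNIV (\<lambda>x. y x i)" for i
  proof -
    obtain L where "L-lipschitz_on UNIV (\<lambda>x::real^'n^'m. x $ i)"
      using bounded_linear.lipschitz_boundE[OF bounded_linear_vec_nth] by blast
    then show ?thesis
      unfolding y_def by (rule bounded_lipschitz_compose[OF bounded_lipschitz_radial_retraction])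
  qed
  then have "bounded_lipschitz UNIV (\<lambda>x. \<chi> i. g x i)"
    unfolding g_def by (intro bounded_lipschitz_vec bounded_lipschitz_intros)
  then obtain L where "L-lipschitz_on UNIV (\<lambda>x. \<chi> i. g x i)"
    by (auto simp: bounded_lipschitz_def)
  then obtain r where r0: "r 0 = x0" and
    r: "\<And>t. t \<ge> 0 \<Longrightarrow> (r has_vector_derivative (\<chi> i. g (r t) i)) (at t within {0..})"
    by (rule lipschitz_ode_global_solution[where z = x0]) blast
  have ri: "((\<lambda>t. r t $ i) has_vector_derivative g (r t) i) (at t within {0..})" if "t \<ge> 0" for t i
    using bounded_linear.has_vector_derivative[OF bounded_linear_vec_nth r[OF that], of i] by simp
  have tangent: "x $ i \<bullet> g x i = 0" for x i
  proof -
    have "y x i \<bullet> (\<Omega> i *v y x i) = 0"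
      using inner_skew[OF skew, of "y x i" i "y x i"] by (simp add: inner_commute)
    \<comment> \<open>In each coupling summand the two products
      \<open>(y x i \<bullet> y x i) * (y x i \<bullet> y x j)\<close> cancel; this is the purpose
      of the extra factor.\<close>
    then have "y x i \<bullet> g x i = 0"
      by (simp add: g_def inner_add_right inner_sum_right inner_diff_right)
    moreover have "x $ i = max 1 (norm (x $ i)) *\<^sub>R y x i" by (simp add: y_def)
    ultimately show ?thesis by (metis inner_scaleR_left mult_zero_right)
  qed
  have norm1: "norm (r t $ i) = 1" if "t \<ge> 0" for t i
    using inner_self_constant[OF ri tangent that] x0 by (simp add: r0)
  have "g (r t) i = kuramoto_field \<Omega> k A (r t) i" if "t \<ge> 0" for t i
    using norm1[OF that] by (simp add: g_def y_def kuramoto_field_def dot_square_norm)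
  then have "kuramoto_solution \<Omega> k A r"
    using ri norm1 by (simp add: kuramoto_solution_def)
  then show thesis using that r0 by blast
qed

section \<open>Synchronization forces a nonzero vector in the common power space\<close>

lemma bounded_lipschitz_component:
  "bounded_lipschitz {x :: real^'n^'m. \<forall>i. norm (x $ i) = 1} (\<lambda>x. x $ i)"
proof -
  obtain L where "L-lipschitz_on {x. \<forall>i. norm (x $ i) = 1} (\<lambda>x::real^'n^'m. x $ i)"
    using bounded_linear.lipschitz_boundE[OF bounded_linear_vec_nth] by blast
  then show ?thesis by (auto simp: bounded_lipschitz_def bounded_iff)
qed

text \<open>The field is bounded on the product of unit spheres, where the solution stays, so the
  solution has bounded derivative.\<close>

lemma bounded_lipschitz_kuramoto_solution:
  fixes \<Omega> :: "'m::finite \<Rightarrow> real^'n^'n"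
  assumes "kuramoto_solution \<Omega> k A r"
  shows "bounded_lipschitz {0..} (\<lambda>t. r t $ i)"
proof (rule bounded_lipschitz_halfline)
  have "bounded_lipschitz {x. \<forall>i. norm (x $ i) = 1} (\<lambda>x. kuramoto_field \<Omega> k A x i)"
    unfolding kuramoto_field_def by (intro bounded_lipschitz_intros bounded_lipschitz_component)
  then have "bounded ((\<lambda>x. kuramoto_field \<Omega> k A x i) ` {x. \<forall>i. norm (x $ i) = 1})"
    by (simp add: bounded_lipschitz_def)
  then show "bounded ((\<lambda>t. kuramoto_field \<Omega> k A (r t) i) ` {0..})"
    by (rule bounded_subset) (use assms in \<open>auto simp: kuramoto_solution_def\<close>)
  show "bounded ((\<lambda>t. r t $ i) ` {0..})"
    using assms by (auto simp: bounded_iff kuramoto_solution_def)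
qed (use assms in \<open>simp add: kuramoto_solution_def\<close>)

lemma norm_diff_unit_sq:
  fixes x y :: "'a::real_inner"
  assumes "norm x = 1" "norm y = 1"
  shows "(norm (x - y))\<^sup>2 = 2 * (1 - x \<bullet> y)"
  using assms unfolding norm_eq_1
  by (simp add: power2_norm_eq_inner inner_diff_left inner_diff_right inner_commute[of y x])

text \<open>Synchronization makes the coupling term vanish in the limit, so asymptotically each
  oscillator just follows its own rotation. Differentiating a quantity \<open>D *v r t $ i\<close>
  that tends to 0 then yields the same for \<open>D *v (\<Omega> i *v r t $ i)\<close>, which raises
  the power by one.\<close>

lemma phase_sync_frequency_difference:
  fixes \<Omega> :: "'m::finite \<Rightarrow> real^'n^'n"
  assumes sol: "kuramoto_solution \<Omega> k A r" and sync: "complete_phase_sync r"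
  shows "((\<lambda>t. matpow (\<Omega> i) l *v (r t $ i) - matpow (\<Omega> j) l *v (r t $ i)) \<longlongrightarrow> 0) at_top"
proof -
  define c where "c i x = k *\<^sub>R (\<Sum>j\<in>UNIV. (A $ i $ j) *\<^sub>R (x $ j - (x $ i \<bullet> x $ j) *\<^sub>R x $ i))"
    for i and x :: "real^'n^'m"
  have F: "kuramoto_field \<Omega> k A x i = \<Omega> i *v (x $ i) + c i x" for x i
    by (simp add: kuramoto_field_def c_def)
  have der: "((\<lambda>s. r s $ i) has_vector_derivative \<Omega> i *v (r t $ i) + c i (r t)) (at t within {0..})"
    and nrm: "norm (r t $ i) = 1" if "t \<ge> 0" for t i
    using sol that by (auto simp: kuramoto_solution_def F)
  have diff: "((\<lambda>t. r t $ i - r t $ j) \<longlongrightarrow> 0) at_top" for i j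
    using sync by (simp add: complete_phase_sync_def)
  have BL: "bounded_lipschitz {0..} (\<lambda>t. r t $ i)" for i
    by (rule bounded_lipschitz_kuramoto_solution[OF sol])
  have BLc: "bounded_lipschitz {0..} (\<lambda>t. c i (r t))" for i
    unfolding c_def by (intro bounded_lipschitz_intros BL)
  have c0: "((\<lambda>t. c i (r t)) \<longlongrightarrow> 0) at_top" for i
  proof -
    \<comment> \<open>The vector is \<open>r t $ j - r t $ i\<close> plus a multiple of
      \<open>r t $ i\<close> whose coefficient \<open>1 - r t $ i \<bullet> r t $ j\<close> is half
      the squared distance of the two unit vectors.\<close>
    have "((\<lambda>t. r t $ j - (r t $ i \<bullet> r t $ j) *\<^sub>R r t $ i) \<longlongrightarrow> 0) at_top" for j
    proof (rule Lim_null_comparison)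
      show "((\<lambda>t. norm (r t $ i - r t $ j) + (norm (r t $ i - r t $ j))\<^sup>2 / 2) \<longlongrightarrow> 0) at_top"
        using tendsto_add[OF tendsto_norm[OF diff[of i j]]
            tendsto_divide[OF tendsto_power[OF tendsto_norm[OF diff[of i j]], of 2] tendsto_const[of 2]]]
        by simp
      show "\<forall>\<^sub>F t in at_top. norm (r t $ j - (r t $ i \<bullet> r t $ j) *\<^sub>R r t $ i)
          \<le> norm (r t $ i - r t $ j) + (norm (r t $ i - r t $ j))\<^sup>2 / 2"
        using eventually_ge_at_top[of 0]
      proof eventually_elim
        case (elim t)
        have "r t $ j - (r t $ i \<bullet> r t $ j) *\<^sub>R r t $ i
            = (r t $ j - r t $ i) + (1 - r t $ i \<bullet> r t $ j) *\<^sub>R r t $ i"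
          by (simp add: algebra_simps)
        moreover have "norm ((1 - r t $ i \<bullet> r t $ j) *\<^sub>R r t $ i) = (norm (r t $ i - r t $ j))\<^sup>2 / 2"
          using norm_diff_unit_sq[OF nrm nrm, OF elim elim, of i j] nrm[OF elim, of i]
            norm_cauchy_schwarz[of "r t $ i" "r t $ j"] nrm[OF elim, of j] by simp
        ultimately show ?case
          using norm_triangle_ineq[of "r t $ j - r t $ i"] by (metis norm_minus_commute)
      qed
    qed
    then have "((\<lambda>t. c i (r t)) \<longlongrightarrow> k *\<^sub>R (\<Sum>j\<in>UNIV. (A $ i $ j) *\<^sub>R 0)) at_top"
      unfolding c_def by (intro tendsto_intros)
    then show ?thesis by simp
  qed
  have mat0: "((\<lambda>t. M *v f t) \<longlongrightarrow> 0) at_top" if "(f \<longlongrightarrow> 0) at_top"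
    for f :: "real \<Rightarrow> real^'n" and M :: "real^'n^'n"
    using bounded_linear.tendsto_zero[OF matrix_vector_mul_bounded_linear that] .
  \<comment> \<open>The first power comes from Barbalat's lemma for
    \<open>r t $ i - r t $ j\<close>, after removing the coupling terms and replacing
    \<open>r t $ j\<close> by \<open>r t $ i\<close>.\<close>
  have freq: "((\<lambda>t. \<Omega> i *v (r t $ i) - \<Omega> j *v (r t $ i)) \<longlongrightarrow> 0) at_top" for i j
  proof -
    have "bounded_lipschitz {0..}
        (\<lambda>t. \<Omega> i *v (r t $ i) + c i (r t) - (\<Omega> j *v (r t $ j) + c j (r t)))"
      by (intro bounded_lipschitz_intros BL BLc)
    then obtain L where
      "L-lipschitz_on {0..} (\<lambda>t. \<Omega> i *v (r t $ i) + c i (r t) - (\<Omega> j *v (r t $ j) + c j (r t)))"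
      by (auto simp: bounded_lipschitz_def)
    then have "((\<lambda>t. \<Omega> i *v (r t $ i) + c i (r t) - (\<Omega> j *v (r t $ j) + c j (r t))) \<longlongrightarrow> 0) at_top"
      by (intro barbalat[OF has_vector_derivative_diff[OF der der] _ diff[of i j]])
    from tendsto_diff[OF this tendsto_diff[OF c0[of i] c0[of j]]]
    have "((\<lambda>t. \<Omega> i *v (r t $ i) - \<Omega> j *v (r t $ j)) \<longlongrightarrow> 0) at_top"
      by (simp add: algebra_simps)
    from tendsto_diff[OF this mat0[OF diff[of i j], of "\<Omega> j"]]
    show ?thesis by (simp add: matrix_vector_mult_diff_distrib)
  qed
  show ?thesis
  proof (induction l arbitrary: i j)
    case 0
    then show ?case by simp
  next
    case (Suc l)
    define D where "D = matpow (\<Omega> i) l - matpow (\<Omega> j) l"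
    \<comment> \<open>\<open>matpow\<close> splits off a factor on the left, whereas differentiation
      produces it on the right.\<close>
    have comm: "matpow M (Suc l) *v x = matpow M l *v (M *v x)" for M :: "real^'n^'n" and x
    proof -
      have "M ** matpow M l = matpow M l ** M"
      proof (induction l)
        case (Suc l)
        then show ?case by (simp only: matpow.simps matrix_mul_assoc)
      qed simp
      then show ?thesis by (simp add: matrix_vector_mul_assoc)
    qed
    have "((\<lambda>t. D *v (r t $ i)) \<longlongrightarrow> 0) at_top"
      using Suc by (simp add: D_def matrix_vector_mult_diff_rdistrib)
    moreover have "bounded_lipschitz {0..} (\<lambda>t. D *v (\<Omega> i *v (r t $ i) + c i (r t)))"
      by (intro bounded_lipschitz_intros BL BLc)
    then obtain L where "L-lipschitz_on {0..} (\<lambda>t. D *v (\<Omega> i *v (r t $ i) + c i (r t)))"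
      by (auto simp: bounded_lipschitz_def)
    ultimately have "((\<lambda>t. D *v (\<Omega> i *v (r t $ i) + c i (r t))) \<longlongrightarrow> 0) at_top"
      by (intro barbalat[OF bounded_linear.has_vector_derivative[OF
            matrix_vector_mul_bounded_linear der]])
    from tendsto_diff[OF this mat0[OF c0[of i], of D]]
    have "((\<lambda>t. D *v (\<Omega> i *v (r t $ i))) \<longlongrightarrow> 0) at_top"
      by (simp add: matrix_vector_right_distrib)
    \<comment> \<open>The difference of the powers \<open>Suc l\<close> is \<open>D ** \<Omega> i +
      matpow (\<Omega> j) l ** (\<Omega> i - \<Omega> j)\<close>.\<close>
    from tendsto_add[OF this mat0[OF freq[of i j], of "matpow (\<Omega> j) l"]]
    show ?case
      unfolding comm by (simp add: D_def matrix_vector_mult_diff_rdistrib matrix_vector_mult_diff_distrib)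
  qed
qed

lemma phase_sync_imp_common_power_space:
  fixes \<Omega> :: "'m::finite \<Rightarrow> real^'n^'n"
  assumes sol: "kuramoto_solution \<Omega> k A r" and sync: "complete_phase_sync r"
  shows "dim (common_power_space \<Omega>) > 0"
proof -
  fix a :: 'm
  have "\<forall>n. r (real n) $ a \<in> sphere 0 1"
    using sol by (simp add: kuramoto_solution_def)
  then obtain x and s :: "nat \<Rightarrow> nat" where x: "x \<in> sphere 0 1" and s: "strict_mono s"
    and lim: "((\<lambda>n. r (real n) $ a) \<circ> s) \<longlonglongrightarrow> x"
    using compact_sphere[of 0 1] unfolding compact_eq_seq_compact_metric seq_compact_def by metis
  have top: "filterlim (\<lambda>n. real (s n)) at_top sequentially"
    using filterlim_compose[OF filterlim_real_sequentially filterlim_subseq[OF s]] .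
  have "matpow (\<Omega> i) l *v x = matpow (\<Omega> j) l *v x" for i j l
  proof -
    have "(\<lambda>n. r (real (s n)) $ i - r (real (s n)) $ a) \<longlonglongrightarrow> 0"
      using sync filterlim_compose[OF _ top] unfolding complete_phase_sync_def by blast
    \<comment> \<open>By synchronization, the limit point found for the one oscillator
      \<open>a\<close> is the limit of all of them along the same times.\<close>
    from tendsto_add[OF this lim] have "(\<lambda>n. r (real (s n)) $ i) \<longlonglongrightarrow> x"
      by (simp add: o_def)
    then have "(\<lambda>n. matpow (\<Omega> i) l *v (r (real (s n)) $ i) - matpow (\<Omega> j) l *v (r (real (s n)) $ i))
        \<longlonglongrightarrow> matpow (\<Omega> i) l *v x - matpow (\<Omega> j) l *v x"
      by (intro tendsto_diff bounded_linear.tendsto[OF matrix_vector_mul_bounded_linear])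
    moreover have "(\<lambda>n. matpow (\<Omega> i) l *v (r (real (s n)) $ i) - matpow (\<Omega> j) l *v (r (real (s n)) $ i))
        \<longlonglongrightarrow> 0"
      using filterlim_compose[OF phase_sync_frequency_difference[OF sol sync] top] .
    ultimately show ?thesis using LIMSEQ_unique by fastforce
  qed
  then have "x \<in> common_power_space \<Omega>" by (simp add: common_power_space_def)
  moreover have "x \<noteq> 0" using x by auto
  ultimately show ?thesis using dim_eq_0[of "common_power_space \<Omega>"] by blast
qed

section \<open>Monotone limits, a minimum principle and the Laplacian's left null vector\<close>

lemma nonneg_derivative_bounded_imp_convergent:
  fixes f f' :: "real \<Rightarrow> real"
  assumes der: "\<And>t. t \<ge> 0 \<Longrightarrow> (f has_real_derivative f' t) (at t within {0..})"
    and nonneg: "\<And>t. t \<ge> 0 \<Longrightarrow> 0 \<le> f' t" and bound: "\<And>t. t \<ge> 0 \<Longrightarrow> f t \<le> C"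
  shows "\<exists>l. (f \<longlongrightarrow> l) at_top"
proof
  have mono: "f s \<le> f t" if "0 \<le> s" "s \<le> t" for s t
  proof (cases "s = t")
    case False
    have "\<exists>x\<in>{s<..<t}. f t - f s = f' x * (t - s)"
    proof (rule mvt_simple[of s t f "\<lambda>x h. f' x * h"])
      fix x assume "s \<le> x" "x \<le> t"
      then show "(f has_derivative (\<lambda>h. f' x * h)) (at x within {s..t})"
        using der[of x] that unfolding has_field_derivative_def
        by (auto intro: has_derivative_subset)
    qed (use False that in simp)
    then obtain x where "s < x" "f t - f s = f' x * (t - s)" by auto
    moreover have "0 \<le> f' x * (t - s)" using nonneg[of x] \<open>s < x\<close> that by simp
    ultimately show ?thesis by linarith
  qed simp
  have bdd: "bdd_above (f ` {0..})" using bound by (auto simp: bdd_above_def)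
  show "(f \<longlongrightarrow> (SUP t\<in>{0..}. f t)) at_top"
  proof (rule increasing_tendsto)
    show "\<forall>\<^sub>F t in at_top. f t \<le> (SUP t\<in>{0..}. f t)"
      using eventually_ge_at_top[of 0] by eventually_elim (auto intro: cSUP_upper bdd)
    fix x assume "x < (SUP t\<in>{0..}. f t)"
    then obtain s where "s \<ge> 0" "x < f s" using less_cSUP_iff[OF _ bdd] by auto
    then show "\<forall>\<^sub>F t in at_top. x < f t"
      unfolding eventually_at_top_linorder using mono less_le_trans by blast
  qed
qed

text \<open>Adding the tilt \<open>e * (1 + t)\<close> makes the derivative strictly positive at a
  positive minimum. At the first time when some tilted component is down to \<open>c\<close>, that
  derivative would put the component below \<open>c\<close> even earlier.\<close>

lemma minimum_principle:
  fixes u u' :: "real \<Rightarrow> 'm::finite \<Rightarrow> real"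
  assumes der: "\<And>t i. t \<ge> 0 \<Longrightarrow> ((\<lambda>s. u s i) has_real_derivative u' t i) (at t within {0..})"
    and min: "\<And>t i. t \<ge> 0 \<Longrightarrow> 0 < u t i \<Longrightarrow> (\<And>j. u t i \<le> u t j) \<Longrightarrow> 0 \<le> u' t i"
    and init: "\<And>i. c \<le> u 0 i" and "c > 0" and "T \<ge> 0"
  shows "c \<le> u T i"
proof (rule ccontr)
  assume "\<not> c \<le> u T i"
  \<comment> \<open>Chosen so that \<open>e * (1 + T)\<close> is below both \<open>c\<close>, which
    keeps \<open>u\<close> positive at the contact time, and \<open>c - u T i\<close>, which keeps
    the tilted component below \<open>c\<close> at \<open>T\<close>. The 1 in \<open>1 + t\<close>
    excludes contact at time 0.\<close>
  define e where "e = min c (c - u T i) / (2 * (1 + T))"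
  define g where "g t j = u t j + e * (1 + t)" for t j
  have "e > 0" using \<open>c > 0\<close> \<open>T \<ge> 0\<close> \<open>\<not> c \<le> u T i\<close> by (simp add: e_def)
  have "e * (1 + T) = min c (c - u T i) / 2"
    using \<open>T \<ge> 0\<close> unfolding e_def by (simp add: field_simps)
  then have eT: "e * (1 + T) < c" "g T i < c"
    using \<open>c > 0\<close> \<open>\<not> c \<le> u T i\<close> by (auto simp: g_def min_def split: if_splits)
  have gder: "((\<lambda>s. g s j) has_real_derivative u' t j + e) (at t within {0..})" if "t \<ge> 0" for t j
    unfolding g_def using der[OF that] by (auto intro!: derivative_eq_intros)
  have gcont: "continuous_on {0..t} (\<lambda>s. g s j)" for t j
    by (rule continuous_on_subset[of "{0..}"])
       (auto simp: continuous_on_eq_continuous_within intro: DERIV_continuous gder)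
  define B where "B = (\<Union>j. {t \<in> {0..T}. g t j \<le> c})"
  have "compact B"
    unfolding B_def
  proof (intro compact_UN)
    show "compact {t \<in> {0..T}. g t j \<le> c}" for j
    proof -
      have "closed {t \<in> {0..T}. g t j \<le> c}"
        by (intro continuous_on_closed_Collect_le gcont continuous_intros)
      moreover have "bounded {t \<in> {0..T}. g t j \<le> c}"
        by (rule bounded_subset[of "{0..T}"]) auto
      ultimately show ?thesis by (simp add: compact_eq_bounded_closed)
    qed
  qed simp
  moreover have "T \<in> B" using \<open>T \<ge> 0\<close> eT unfolding B_def by (auto intro!: exI[of _ i])
  ultimately obtain s where "s \<in> B" and first: "\<And>t. t \<in> B \<Longrightarrow> s \<le> t"
    using compact_attains_inf[of B] by blast
  then obtain j0 where s: "0 \<le> s" "s \<le> T" "g s j0 \<le> c" by (auto simp: B_def)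
  \<comment> \<open>The tilt is the same for all indices, so a minimizer of \<open>u s\<close> also
    minimizes \<open>g s\<close>; the choice of \<open>s\<close> then forces
    \<open>g s j = c\<close>.\<close>
  obtain j where j: "\<And>l. u s j \<le> u s l"
    using ex_min_if_finite[of "range (u s)"] by (auto simp: not_less)
  have "g s j \<le> c" using j[of j0] s by (simp add: g_def)
  moreover have "c \<le> g 0 j" using init[of j] \<open>e > 0\<close> by (simp add: g_def)
  ultimately obtain t where t: "0 \<le> t" "t \<le> s" "g t j = c"
    using IVT2'[of "\<lambda>t. g t j" s c 0] gcont s by blast
  have "t \<in> B" using t s unfolding B_def by auto
  with first t have "g s j = c" by fastforce
  have "e * (1 + s) \<le> e * (1 + T)" using s \<open>e > 0\<close> by simp
  then have "u s j > 0" using \<open>g s j = c\<close> eT unfolding g_def by linarith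
  then have "u' s j + e > 0" using min[of s j] j s \<open>e > 0\<close> by force
  then obtain d where d: "d > 0" "\<And>h. h > 0 \<Longrightarrow> s - h \<in> {0..} \<Longrightarrow> h < d \<Longrightarrow> g (s - h) j < g s j"
    using has_real_derivative_pos_inc_left[OF gder] s by blast
  have "s \<noteq> 0" using init[of j] \<open>e > 0\<close> \<open>g s j = c\<close> by (auto simp: g_def)
  then have "g (s - min s (d / 2)) j < c"
    using d s \<open>g s j = c\<close> by (intro d(2)[THEN less_le_trans]) auto
  then have "s - min s (d / 2) \<in> B" using s d unfolding B_def by (auto intro!: exI[of _ j])
  then show False using first d \<open>s \<noteq> 0\<close> s by fastforce
qed

text \<open>If \<open>q\<close> is a left null vector of the Laplacian, so is \<open>\<bar>q\<bar>\<close>, because summing the triangle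
  inequality over all vertices gives an equality.\<close>

lemma positive_left_null_vector:
  fixes A :: "real^'m^'m"
  assumes conn: "strongly_connected_digraph E" and adj: "weighted_adjacency E A"
  obtains w :: "'m \<Rightarrow> real" where "\<And>i. w i > 0"
    "\<And>j. (\<Sum>i\<in>UNIV. w i * A $ i $ j) = w j * (\<Sum>l\<in>UNIV. A $ j $ l)"
proof -
  have A0: "A $ i $ j \<ge> 0" for i j
    using adj unfolding weighted_adjacency_def by (metis order_less_imp_le order_refl)
  define d where "d j = (\<Sum>l\<in>UNIV. A $ j $ l)" for j
  have d0: "d j \<ge> 0" for j unfolding d_def by (intro sum_nonneg A0)
  \<comment> \<open>The graph Laplacian. Its rows sum to 0, so it is singular, and so is its
    transpose.\<close>
  define M :: "real^'m^'m" where "M = (\<chi> i j. (if i = j then d i else 0) - A $ i $ j)"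
  have "M *v 1 = 0"
    by (simp add: M_def matrix_vector_mult_def vec_eq_iff sum_subtractf d_def)
  have det: "det B = 0 \<longleftrightarrow> (\<exists>x. x \<noteq> 0 \<and> B *v x = 0)" for B :: "real^'m^'m"
    using invertible_det_nz[of B] matrix_left_invertible_ker[of B] by (auto simp: invertible_left_inverse)
  have "(1 :: real^'m) \<noteq> 0" by (simp add: vec_eq_iff)
  then have "det M = 0" using det[of M] \<open>M *v 1 = 0\<close> by blast
  then have "det (transpose M) = 0" by (simp only: det_transpose)
  then obtain q where "q \<noteq> 0" "transpose M *v q = 0" using det by blast
  then have null: "(\<Sum>i\<in>UNIV. q $ i * A $ i $ j) = q $ j * d j" for j
  proof -
    have "0 = (transpose M *v q) $ j" using \<open>transpose M *v q = 0\<close> by simp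
    also have "\<dots> = (\<Sum>i\<in>UNIV. (if i = j then d i else 0) * q $ i - A $ i $ j * q $ i)"
      by (simp add: M_def matrix_vector_mult_def transpose_def left_diff_distrib)
    also have "\<dots> = d j * q $ j - (\<Sum>i\<in>UNIV. A $ i $ j * q $ i)"
      by (simp add: sum_subtractf if_distrib[of "\<lambda>x. x * _"] cong: if_cong)
    finally show ?thesis by (simp add: mult.commute)
  qed
  define w where "w i = \<bar>q $ i\<bar>" for i
  have "w j * d j \<le> (\<Sum>i\<in>UNIV. w i * A $ i $ j)" for j
  proof -
    have "w j * d j = \<bar>\<Sum>i\<in>UNIV. q $ i * A $ i $ j\<bar>" using null[of j] d0 by (simp add: w_def abs_mult)
    also have "\<dots> \<le> (\<Sum>i\<in>UNIV. w i * A $ i $ j)"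
      using A0 by (intro order_trans[OF sum_abs]) (simp add: w_def abs_mult)
    finally show ?thesis .
  qed
  moreover have "(\<Sum>j\<in>UNIV. w j * d j) = (\<Sum>j\<in>UNIV. \<Sum>i\<in>UNIV. w i * A $ i $ j)"
    by (subst sum.swap) (simp add: d_def sum_distrib_left)
  ultimately have eq: "w j * d j = (\<Sum>i\<in>UNIV. w i * A $ i $ j)" for j
    using sum_mono_inv[of "\<lambda>j. w j * d j" UNIV "\<lambda>j. \<Sum>i\<in>UNIV. w i * A $ i $ j" j] by simp
  have w0: "w i \<ge> 0" for i by (simp add: w_def)
  have "w i \<noteq> 0" for i
  proof
    assume "w i = 0"
    \<comment> \<open>A zero of \<open>w\<close> spreads along edges: if \<open>w j = 0\<close>, the
      balance equation at \<open>j\<close> kills every \<open>w l * A $ l $ j\<close>, and an edge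
      from \<open>j\<close> to \<open>l\<close> has positive weight.\<close>
    have "w l = 0" if "(i, l) \<in> E\<^sup>*" for l
      using that
    proof induction
      case base
      show ?case by fact
    next
      case (step j l)
      have "(\<Sum>i\<in>UNIV. w i * A $ i $ j) = 0" using eq[of j] step.IH by simp
      then have "w l * A $ l $ j = 0"
        using A0 w0 by (subst (asm) sum_nonneg_eq_0_iff) auto
      moreover have "A $ l $ j > 0" using adj step unfolding weighted_adjacency_def by meson
      ultimately show ?case by simp
    qed
    then have "q = 0"
      using conn by (simp add: strongly_connected_digraph_def w_def vec_eq_iff)
    with \<open>q \<noteq> 0\<close> show False ..
  qed
  then show thesis
    using that[of w] w0 eq unfolding d_def by (metis less_le)
qed

section \<open>A common rotating direction inside the common power space\<close>

text \<open>Among the \<open>CARD('n) + 1\<close> vectors \<open>v 0, v 1, ...\<close> some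
  \<open>v d\<close> depends linearly on its predecessors, so their span is invariant. Only powers
  up to \<open>d \<le> CARD('n)\<close> enter, which is why the powers in
  \<open>common_power_space\<close> determine everything.\<close>

lemma common_invariant_subspace:
  fixes \<Omega> :: "'m \<Rightarrow> real^'n^'n"
  assumes p: "p \<in> common_power_space \<Omega>" "p \<noteq> 0"
  obtains K where "subspace K" "p \<in> K" "\<And>i x. x \<in> K \<Longrightarrow> \<Omega> i *v x \<in> K"
    "\<And>i j x. x \<in> K \<Longrightarrow> \<Omega> i *v x = \<Omega> j *v x"
proof -
  fix a :: 'm
  define v where "v l = matpow (\<Omega> a) l *v p" for l
  have v: "matpow (\<Omega> i) l *v p = v l" if "l \<le> CARD('n)" for i l
  proof (cases "l = 0")
    case False
    then have "l \<in> {1..CARD('n)}" using that by auto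
    then show ?thesis using p(1) unfolding common_power_space_def v_def by blast
  qed (simp add: v_def)
  have "\<exists>d\<le>CARD('n). v d \<in> span (v ` {..<d})"
  proof (rule ccontr)
    assume neg: "\<not> ?thesis"
    have "d \<le> Suc CARD('n) \<Longrightarrow> dim (v ` {..<d}) = d" for d
    proof (induction d)
      case (Suc d)
      then have "v d \<notin> span (v ` {..<d})" using neg by auto
      then show ?case using Suc by (simp add: lessThan_Suc dim_insert)
    qed simp
    from this[of "Suc CARD('n)"] show False
      using dim_subset_UNIV_cart[of "v ` {..<Suc CARD('n)}"] by simp
  qed
  then obtain d where d: "d \<le> CARD('n)" "v d \<in> span (v ` {..<d})" by blast
  define K where "K = span (v ` {..<d})"
  have step: "\<Omega> i *v v l = v (Suc l)" if "l < d" for i l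
  proof -
    have "\<Omega> i *v v l = \<Omega> i *v (matpow (\<Omega> i) l *v p)" using v[of l i] that d by simp
    also have "\<dots> = matpow (\<Omega> i) (Suc l) *v p" by (simp add: matrix_vector_mul_assoc)
    also have "\<dots> = v (Suc l)" using that d by (intro v) simp
    finally show ?thesis .
  qed
  show thesis
  proof (rule that)
    show "subspace K" by (simp add: K_def)
    have "v 0 = p" by (simp add: v_def)
    then have "d \<noteq> 0" using d p(2) by (intro notI) simp
    then show "p \<in> K"
      using \<open>v 0 = p\<close> unfolding K_def by (intro span_base) (force intro: image_eqI[of _ _ 0])
    fix i j x assume x: "x \<in> K"
    show "\<Omega> i *v x \<in> K"
      using x unfolding K_def
    proof (induction rule: span_induct)
      case base
      show ?case
        by (rule subspaceI) (auto simp: matrix_vector_right_distrib matrix_vector_mult_scaleR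
            intro: span_add span_scale span_0)
    next
      case (step x)
      then obtain l where "l < d" "x = v l" by auto
      then show ?case
        using d(2) \<open>\<And>l i. l < d \<Longrightarrow> \<Omega> i *v v l = v (Suc l)\<close>
        by (cases "Suc l = d") (auto intro: span_base)
    qed
    show "\<Omega> i *v x = \<Omega> j *v x"
      using x unfolding K_def
      by (rule linear_eq_on_span[rotated 3])
         (auto simp: step matrix_vector_mul_linear)
  qed
qed

text \<open>Projecting onto the invariant space \<open>K\<close> before applying
  \<open>\<Omega> a\<close> keeps every velocity in \<open>K\<close>, so a curve starting in
  \<open>K\<close> never leaves it. There the projection does nothing and all the matrices
  agree.\<close>

lemma common_rotation:
  fixes \<Omega> :: "'m \<Rightarrow> real^'n^'n"
  assumes skew: "\<And>i. skew_symmetric (\<Omega> i)" and z: "z \<in> common_power_space \<Omega>" "z \<noteq> 0"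
  obtains p where "p 0 = z" "\<And>t. t \<ge> 0 \<Longrightarrow> norm (p t) = norm z"
    "\<And>t i. t \<ge> 0 \<Longrightarrow> (p has_vector_derivative \<Omega> i *v p t) (at t within {0..})"
proof -
  fix a :: 'm
  obtain K where K: "subspace K" "z \<in> K" and inv: "\<And>i x. x \<in> K \<Longrightarrow> \<Omega> i *v x \<in> K"
    and eq: "\<And>i j x. x \<in> K \<Longrightarrow> \<Omega> i *v x = \<Omega> j *v x"
    using common_invariant_subspace[OF z] by blast
  have K': "convex K" "closed K" "K \<noteq> {}"
    using K by (auto simp: subspace_imp_convex closed_subspace)
  have "1-lipschitz_on UNIV (closest_point K)"
    using closest_point_lipschitz[OF K'] by (auto intro: lipschitz_onI)
  moreover obtain L where "L-lipschitz_on (range (closest_point K)) ((*v) (\<Omega> a))"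
    using bounded_linear.lipschitz_boundE[OF matrix_vector_mul_bounded_linear] by blast
  ultimately have "(L * 1)-lipschitz_on UNIV (\<lambda>x. \<Omega> a *v closest_point K x)"
    by (rule lipschitz_on_compose2)
  then obtain p where p0: "p 0 = z" and
    der: "\<And>t. t \<ge> 0 \<Longrightarrow> (p has_vector_derivative \<Omega> a *v closest_point K (p t)) (at t within {0..})"
    by (rule lipschitz_ode_global_solution[where z = z]) blast
  have pK: "p t \<in> K" if "t \<ge> 0" for t
  proof -
    \<comment> \<open>\<open>q\<close> is the component normal to \<open>K\<close> at the fixed time
      \<open>t\<close>; since velocities lie in \<open>K\<close>, its inner product with the curve
      keeps its initial value 0, which gives \<open>q \<bullet> q = 0\<close>.\<close>
    obtain y q where y: "y \<in> span K" and q: "\<And>w. w \<in> span K \<Longrightarrow> orthogonal q w" and "p t = y + q"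
      using orthogonal_subspace_decomp_exists[of K "p t"] by blast
    have "((\<lambda>s. q \<bullet> p s) has_real_derivative 0) (at s within {0..})" if "s \<in> {0..}" for s
    proof -
      have "q \<bullet> (\<Omega> a *v closest_point K (p s)) = 0"
        using q[OF span_base[OF inv[OF closest_point_in_set[OF K'(2,3)]]]] by (simp add: orthogonal_def)
      then show ?thesis
        using has_vector_derivative_inner[OF has_vector_derivative_const der, of s q] that by simp
    qed
    then obtain C where "\<And>s. s \<in> {0..} \<Longrightarrow> q \<bullet> p s = C"
      using has_field_derivative_zero_constant[of "{0..}" "\<lambda>s. q \<bullet> p s"] by auto
    then have "q \<bullet> p t = q \<bullet> z" using p0 that by force
    also have "\<dots> = 0" using q[OF span_base[OF K(2)]] by (simp add: orthogonal_def)
    finally have "q \<bullet> q = 0" using q[OF y] \<open>p t = y + q\<close> by (simp add: orthogonal_def inner_add_right)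
    then show ?thesis using y \<open>p t = y + q\<close> K(1) by (simp add: span_eq_iff[THEN iffD2])
  qed
  have der': "(p has_vector_derivative \<Omega> i *v p t) (at t within {0..})" if "t \<ge> 0" for t i
    using der[OF that] pK[OF that] eq[OF pK[OF that], of a i] by (simp add: closest_point_self)
  moreover have "x \<bullet> (\<Omega> a *v x) = 0" for x
    using inner_skew[OF skew, of x a x] by (simp add: inner_commute)
  ultimately have "norm (p t) = norm z" if "t \<ge> 0" for t
    using inner_self_constant[of p "\<lambda>t. \<Omega> a *v p t", OF der' _ that] p0 by simp
  then show thesis using that p0 der' by blast
qed

section \<open>A nonzero common power vector gives a synchronizing hemisphere\<close>

lemma common_power_space_imp_phase_sync:
  fixes \<Omega> :: "'m::finite \<Rightarrow> real^'n^'n" and A :: "real^'m^'m"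
  assumes skew: "\<And>i. skew_symmetric (\<Omega> i)" and "k > 0"
    and conn: "strongly_connected_digraph E" and adj: "weighted_adjacency E A"
    and z: "z \<in> common_power_space \<Omega>" "z \<noteq> 0"
    and sol: "kuramoto_solution \<Omega> k A r" and init: "\<And>i. r 0 $ i \<in> open_hemisphere z"
  shows "complete_phase_sync r"
proof -
  obtain p where p0: "p 0 = z" and pn: "\<And>t. t \<ge> 0 \<Longrightarrow> norm (p t) = norm z"
    and pder: "\<And>t i. t \<ge> 0 \<Longrightarrow> (p has_vector_derivative \<Omega> i *v p t) (at t within {0..})"
    using common_rotation[OF skew z] by blast
  obtain w where w: "\<And>i. w i > 0"
    "\<And>j. (\<Sum>i\<in>UNIV. w i * A $ i $ j) = w j * (\<Sum>l\<in>UNIV. A $ j $ l)"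
    using positive_left_null_vector[OF conn adj] by blast
  have A0: "A $ i $ j \<ge> 0" for i j
    using adj unfolding weighted_adjacency_def by (metis order_less_imp_le order_refl)
  have nrm: "norm (r t $ i) = 1" if "t \<ge> 0" for t i
    using sol that by (auto simp: kuramoto_solution_def)
  define u where "u t i = p t \<bullet> r t $ i" for t i
  define \<sigma> where "\<sigma> t i j = r t $ i \<bullet> r t $ j" for t i j
  have \<sigma>1: "\<sigma> t i j \<le> 1" if "t \<ge> 0" for t i j
    using norm_cauchy_schwarz[of "r t $ i" "r t $ j"] nrm[OF that] by (simp add: \<sigma>_def)
  define u' where "u' t i = k * (\<Sum>j\<in>UNIV. A $ i $ j * (u t j - \<sigma> t i j * u t i))" for t i
  have uder: "((\<lambda>s. u s i) has_real_derivative u' t i) (at t within {0..})" if "t \<ge> 0" for t i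
  proof -
    have "((\<lambda>s. r s $ i) has_vector_derivative kuramoto_field \<Omega> k A (r t) i) (at t within {0..})"
      using sol that by (simp add: kuramoto_solution_def)
    from has_vector_derivative_inner[OF pder[OF that, of i] this]
    show ?thesis
      using inner_skew[OF skew, of "p t" i "r t $ i"]
      by (simp add: u_def[abs_def] u'_def \<sigma>_def kuramoto_field_def inner_add_right inner_sum_right
          inner_diff_right)
  qed
  define c where "c = Min (range (u 0))"
  have "c > 0"
    unfolding c_def using init by (simp add: open_hemisphere_def u_def p0)
  have u_ge: "c \<le> u t i" if "t \<ge> 0" for t i
  proof (rule minimum_principle[OF uder _ _ \<open>c > 0\<close> that])
    fix t i assume t: "(0::real) \<le> t" "0 < u t i" and le: "\<And>j. u t i \<le> u t j"
    \<comment> \<open>At a positive minimum, \<open>\<sigma> t i j \<le> 1\<close> gives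
      \<open>\<sigma> t i j * u t i \<le> u t i \<le> u t j\<close>, so no coupling term pulls the
      height down.\<close>
    have "\<sigma> t i j * u t i \<le> u t j" for j
      using mult_right_mono[OF \<sigma>1[OF t(1), of i j], of "u t i"] t(2) le[of j] by linarith
    then show "0 \<le> u' t i"
      unfolding u'_def using \<open>k > 0\<close> A0 by (intro mult_nonneg_nonneg sum_nonneg) auto
  qed (simp_all add: c_def)
  define V where "V t = (\<Sum>i\<in>UNIV. w i * u t i)" for t
  define V' where "V' t = k * (\<Sum>i\<in>UNIV. \<Sum>j\<in>UNIV. w i * A $ i $ j * ((1 - \<sigma> t i j) * u t i))" for t
  have Vder: "(V has_real_derivative V' t) (at t within {0..})" if "t \<ge> 0" for t
  proof -
    have "(V has_real_derivative (\<Sum>i\<in>UNIV. w i * u' t i)) (at t within {0..})"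
      unfolding V_def by (intro DERIV_sum DERIV_cmult uder that)
    \<comment> \<open>Split \<open>u t j - \<sigma> t i j * u t i\<close> into
      \<open>u t j - u t i\<close> and \<open>(1 - \<sigma> t i j) * u t i\<close>; the weights
      \<open>w\<close> annihilate the total of the first parts.\<close>
    moreover have "(\<Sum>i\<in>UNIV. w i * u' t i) = V' t"
    proof -
      have "(\<Sum>i\<in>UNIV. \<Sum>j\<in>UNIV. w i * A $ i $ j * u t j) = (\<Sum>j\<in>UNIV. (\<Sum>i\<in>UNIV. w i * A $ i $ j) * u t j)"
        by (subst sum.swap) (simp add: sum_distrib_right)
      also have "\<dots> = (\<Sum>i\<in>UNIV. \<Sum>j\<in>UNIV. w i * A $ i $ j * u t i)"
        unfolding w(2) by (simp add: sum_distrib_left sum_distrib_right)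
      finally have "(\<Sum>i\<in>UNIV. \<Sum>j\<in>UNIV. w i * A $ i $ j * (u t j - u t i)) = 0"
        by (simp add: right_diff_distrib sum_subtractf)
      moreover have "(\<Sum>i\<in>UNIV. w i * u' t i) - V' t
          = k * (\<Sum>i\<in>UNIV. \<Sum>j\<in>UNIV. w i * A $ i $ j * (u t j - u t i))"
        unfolding u'_def V'_def
        by (simp add: sum_distrib_left algebra_simps flip: sum_subtractf)
      ultimately show ?thesis by simp
    qed
    ultimately show ?thesis by simp
  qed
  have pos: "0 \<le> w i * A $ i $ j * ((1 - \<sigma> t i j) * u t i)" if "t \<ge> 0" for t i j
    using A0[of i j] w(1)[of i] \<sigma>1[OF that, of i j] u_ge[OF that, of i] \<open>c > 0\<close> by simp
  have V'_ge: "k * (w i * A $ i $ j * ((1 - \<sigma> t i j) * u t i)) \<le> V' t" if "t \<ge> 0" for t i j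
  proof -
    have "w i * A $ i $ j * ((1 - \<sigma> t i j) * u t i)
        \<le> (\<Sum>j\<in>UNIV. w i * A $ i $ j * ((1 - \<sigma> t i j) * u t i))"
      by (rule member_le_sum) (auto intro: pos[OF that])
    also have "\<dots> \<le> (\<Sum>i\<in>UNIV. \<Sum>j\<in>UNIV. w i * A $ i $ j * ((1 - \<sigma> t i j) * u t i))"
      by (rule member_le_sum[of i UNIV "\<lambda>i. \<Sum>j\<in>UNIV. w i * A $ i $ j * ((1 - \<sigma> t i j) * u t i)"])
         (auto intro!: sum_nonneg pos[OF that])
    finally show ?thesis unfolding V'_def using \<open>k > 0\<close> by simp
  qed
  have "\<exists>l. (V \<longlongrightarrow> l) at_top"
  proof -
    have "0 \<le> V' t" if "t \<ge> 0" for t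
      unfolding V'_def using \<open>k > 0\<close> by (intro mult_nonneg_nonneg[of k] sum_nonneg pos[OF that]) auto
    moreover have "V t \<le> (\<Sum>i\<in>UNIV. w i * norm z)" if "t \<ge> 0" for t
    proof -
      have "u t i \<le> norm z" for i
        using norm_cauchy_schwarz[of "p t" "r t $ i"] nrm[OF that] pn[OF that] by (simp add: u_def)
      then show ?thesis
        unfolding V_def using w(1) by (intro sum_mono mult_left_mono) (auto intro: less_imp_le)
    qed
    ultimately show ?thesis
      using nonneg_derivative_bounded_imp_convergent[OF Vder] by blast
  qed
  then obtain l where "(V \<longlongrightarrow> l) at_top" ..
  moreover have BLr: "bounded_lipschitz {0..} (\<lambda>t. r t $ i)" for i
    by (rule bounded_lipschitz_kuramoto_solution[OF sol])
  moreover have BLp: "bounded_lipschitz {0..} p"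
  proof (rule bounded_lipschitz_halfline[OF pder])
    fix a :: 'm
    show bdd: "bounded (p ` {0..})" using pn by (auto simp: bounded_iff)
    show "bounded ((\<lambda>t. \<Omega> a *v p t) ` {0..})"
      using bounded_linear_image[OF bdd matrix_vector_mul_bounded_linear[of "\<Omega> a"]]
      by (simp add: image_image)
  qed
  moreover have "bounded_lipschitz {0..} V'"
    unfolding V'_def \<sigma>_def u_def by (intro bounded_lipschitz_intros BLr BLp)
  then obtain L where "L-lipschitz_on {0..} V'" by (auto simp: bounded_lipschitz_def)
  ultimately have V'0: "(V' \<longlongrightarrow> 0) at_top"
    using Vder by (intro barbalat) (auto simp: has_real_derivative_iff_has_vector_derivative)
  have edge: "((\<lambda>t. r t $ j - r t $ i) \<longlongrightarrow> 0) at_top" if "(j, i) \<in> E" for i j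
  proof -
    have "A $ i $ j > 0" using adj that unfolding weighted_adjacency_def by meson
    \<comment> \<open>The summand of \<open>V' t\<close> for this edge is at least
      \<open>b * (1 - \<sigma> t i j)\<close>, and \<open>2 * (1 - \<sigma> t i j)\<close> is the
      squared distance of the endpoints.\<close>
    define b where "b = k * w i * A $ i $ j * c"
    have "b > 0" unfolding b_def using \<open>A $ i $ j > 0\<close> \<open>k > 0\<close> \<open>c > 0\<close> w(1) by simp
    have "((\<lambda>t. (norm (r t $ j - r t $ i))\<^sup>2) \<longlongrightarrow> 0) at_top"
    proof (rule Lim_null_comparison)
      show "((\<lambda>t. 2 * V' t / b) \<longlongrightarrow> 0) at_top"
        using tendsto_mult_right_zero[OF V'0, of "2 / b"] by simp
      show "\<forall>\<^sub>F t in at_top. norm ((norm (r t $ j - r t $ i))\<^sup>2) \<le> 2 * V' t / b"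
        using eventually_ge_at_top[of 0]
      proof eventually_elim
        case (elim t)
        have "b * (1 - \<sigma> t i j) = k * (w i * A $ i $ j * ((1 - \<sigma> t i j) * c))"
          by (simp add: b_def)
        also have "\<dots> \<le> k * (w i * A $ i $ j * ((1 - \<sigma> t i j) * u t i))"
          using \<open>k > 0\<close> w(1)[of i] A0[of i j] \<sigma>1[OF elim, of i j] u_ge[OF elim, of i]
          by (intro mult_left_mono) auto
        also have "\<dots> \<le> V' t" by (rule V'_ge[OF elim])
        finally have "1 - \<sigma> t i j \<le> V' t / b" using \<open>b > 0\<close> by (simp add: field_simps)
        then show ?case
          using norm_diff_unit_sq[OF nrm nrm, OF elim elim, of j i]
          unfolding real_norm_def abs_of_nonneg[OF zero_le_power2]
          by (simp add: \<sigma>_def inner_commute)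
      qed
    qed
    then have "((\<lambda>t. sqrt ((norm (r t $ j - r t $ i))\<^sup>2)) \<longlongrightarrow> sqrt 0) at_top"
      by (rule tendsto_real_sqrt)
    then show ?thesis by (simp add: tendsto_norm_zero_iff)
  qed
  have "((\<lambda>t. r t $ j - r t $ i) \<longlongrightarrow> 0) at_top" if "(j, i) \<in> E\<^sup>*" for i j
    using that
  proof induction
    case (step l i)
    show ?case using tendsto_add[OF step.IH edge[OF step(2)]] by simp
  qed simp
  then show ?thesis
    using conn by (simp add: complete_phase_sync_def strongly_connected_digraph_def)
qed

theorem corollary4:
  fixes \<Omega> :: "'m::finite \<Rightarrow> real^'n^'n"
    and k :: real
    and E :: "('m \<times> 'm) set"
    and A :: "real^'m^'m"
  assumes "\<And>i. skew_symmetric (\<Omega> i)"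
    and "\<exists>i j. \<Omega> i \<noteq> \<Omega> j"
    and "k > 0"
    and "strongly_connected_digraph E"
    and "weighted_adjacency E A"
  shows "(\<exists>p. p \<noteq> 0 \<and>
            (\<forall>r. kuramoto_solution \<Omega> k A r \<longrightarrow>
                 (\<forall>i. r 0 $ i \<in> open_hemisphere p) \<longrightarrow>
                 complete_phase_sync r))
         \<longleftrightarrow> dim (common_power_space \<Omega>) > 0"
proof
  assume "\<exists>p. p \<noteq> 0 \<and> (\<forall>r. kuramoto_solution \<Omega> k A r \<longrightarrow>
    (\<forall>i. r 0 $ i \<in> open_hemisphere p) \<longrightarrow> complete_phase_sync r)"
  then obtain p where "p \<noteq> 0" and sync: "\<And>r. kuramoto_solution \<Omega> k A r \<Longrightarrow>
    \<forall>i. r 0 $ i \<in> open_hemisphere p \<Longrightarrow> complete_phase_sync r"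
    by blast
  \<comment> \<open>Starting all oscillators at the pole of the hemisphere ensures that the
    synchronization hypothesis is not vacuous.\<close>
  obtain r where r: "kuramoto_solution \<Omega> k A r" "r 0 = (\<chi> i. p /\<^sub>R norm p)"
  proof (rule kuramoto_solution_exists[where \<Omega> = \<Omega> and k = k and A = A])
    show "norm ((\<chi> i. p /\<^sub>R norm p :: real^'n^'m) $ i) = 1" for i using \<open>p \<noteq> 0\<close> by simp
  qed (use assms(1) in blast)+
  moreover have "\<forall>i. r 0 $ i \<in> open_hemisphere p"
    using r(2) \<open>p \<noteq> 0\<close> by (simp add: open_hemisphere_def)
  ultimately show "dim (common_power_space \<Omega>) > 0"
    using phase_sync_imp_common_power_space sync by blast
next
  assume "dim (common_power_space \<Omega>) > 0"
  then have "\<not> common_power_space \<Omega> \<subseteq> {0}"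
    by (simp flip: dim_eq_0)
  then obtain p where "p \<in> common_power_space \<Omega>" "p \<noteq> 0" by blast
  then show "\<exists>p. p \<noteq> 0 \<and> (\<forall>r. kuramoto_solution \<Omega> k A r \<longrightarrow>
    (\<forall>i. r 0 $ i \<in> open_hemisphere p) \<longrightarrow> complete_phase_sync r)"
    using common_power_space_imp_phase_sync[where \<Omega> = \<Omega>, OF assms(1,3-5)] by blast
qed

end
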